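(* Let $S=\langle a,a+k,a+2k,\ldots,a+(a-1)k\rangle$, where $a$ and $k$ are relatively prime positive integers. If $d$ is a positive integer with $d\mid k$, then $$g(S/d)=\frac{F(S/d)+a-1}{2}.$$
   Context: $\mathbb{N}$ denotes the set of nonnegative integers. A numerical semigroup is a subset of $\mathbb{N}$ that is closed under addition, contains $0$, and has finite complement in $\mathbb{N}$. For positive integers $a_1,\ldots,a_n$ with $\gcd(a_1,\ldots,a_n)=1$, $\langle a_1,\ldots,a_n\rangle=\{c_1a_1+\cdots+c_na_n: c_1,\ldots,c_n\in\mathbb{N}\}$, which is a numerical semigroup. For a numerical semigroup $S$ and a positive integer $d$, the quotient of $S$ by $d$ is $S/d=\{x\in\mathbb{N}: dx\in S\}$, which is again a numerical semigroup. The Frobenius number and genus of a numerical semigroup $S$ are $F(S)=\max(\mathbb{N}\setminus S)$ and $g(S)=|\mathbb{N}\setminus S|$, respectively. *)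

theory Defs
  imports Complex_Main "HOL-Number_Theory.Cong"
begin

definition numerical_semigroup :: "nat set \<Rightarrow> bool" where
  "numerical_semigroup S \<longleftrightarrow>
     0 \<in> S \<and> (\<forall>x\<in>S. \<forall>y\<in>S. x + y \<in> S) \<and> finite (- S)"

(* Intended for finite A only: over an infinite A the sum would be 0. *)
definition generated :: "nat set \<Rightarrow> nat set" where
  "generated A = {(\<Sum>x\<in>A. c x * x) | c :: nat \<Rightarrow> nat. True}"

definition semigroup_quotient :: "nat set \<Rightarrow> nat \<Rightarrow> nat set" where
  "semigroup_quotient S d = {x. d * x \<in> S}"

(* The maximum of the gaps only makes sense for S \<noteq> UNIV.  The value at UNIV is
   a convention: the maximum of the empty set of naturals is read as 0 (not as -1). *)
definition frobenius :: "nat set \<Rightarrow> nat" where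
  "frobenius S = (if S = UNIV then 0 else Max (- S))"

definition genus :: "nat set \<Rightarrow> nat" where
  "genus S = card (- S)"

(* The lemmas below ensure that the sets of gaps in question are finite, so that
   Max and card above have their usual meaning. *)

lemma generated_contains_large_multiples:
  assumes "finite A"
  shows "\<exists>N. \<forall>x\<ge>N. Gcd A dvd x \<longrightarrow> x \<in> generated A"
  using assms
proof (induction A rule: finite_induct)
  case empty
  show ?case by (auto simp: generated_def)
next
  case (insert b A)
  then obtain N where N: "\<And>x. x \<ge> N \<Longrightarrow> Gcd A dvd x \<Longrightarrow> x \<in> generated A"
    by blast
  have ext: "u * b + y \<in> generated (insert b A)" if y: "y \<in> generated A" for u y
  proof -
    obtain c where c: "y = (\<Sum>x\<in>A. c x * x)"
      using y by (auto simp: generated_def)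
    have "(\<Sum>x\<in>A. (c(b := u)) x * x) = (\<Sum>x\<in>A. c x * x)"
      using insert.hyps by (intro sum.cong) auto
    then have "u * b + y = (\<Sum>x\<in>insert b A. (c(b := u)) x * x)"
      using insert.hyps c by simp
    then show ?thesis unfolding generated_def by blast
  qed
  define g where "g = Gcd A"
  show ?case
  proof (intro exI allI impI)
    fix x assume x: "x \<ge> N + g * b" "Gcd (insert b A) dvd x"
    then have dvd: "gcd b g dvd x" by (simp add: g_def)
    show "x \<in> generated (insert b A)"
    proof (cases "g = 0")
      case True
      then obtain u where u: "x = u * b" using dvd by (auto simp: dvd_def mult.commute)
      have "0 \<in> generated A"
        unfolding generated_def by (auto intro!: exI[of _ "\<lambda>_. 0"])
      from ext[OF this] u show ?thesis by simp
    next
      case False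
      obtain t where t: "x = gcd b g * t" using dvd by (auto simp: dvd_def)
      obtain v where v: "[b * v = gcd b g] (mod g)"
        using cong_solve_nat by (metis cong_refl gcd_0_left_nat mult_0 cong_0_iff gcd_nat.refl)
      define u where "u = (v * t) mod g"
      have "[b * u = b * (v * t)] (mod g)"
        unfolding u_def by (intro cong_scalar_left) simp
      also have "[b * (v * t) = x] (mod g)"
        using cong_scalar_right[OF v, of t] t by (simp add: mult.assoc)
      finally have cong: "[x = b * u] (mod g)" by (rule cong_sym)
      have "u \<le> g" using False by (simp add: u_def less_imp_le)
      then have le: "b * u \<le> g * b" by (simp add: mult.commute)
      have "g dvd x - b * u" using cong le x(1) by (simp add: cong_altdef_nat)
      moreover have "x - b * u \<ge> N" using le x(1) by linarith
      ultimately have "x - b * u \<in> generated A" by (auto simp: g_def intro: N)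
      from ext[OF this, of u] show ?thesis using le x(1) by (simp add: mult.commute)
    qed
  qed
qed

lemma numerical_semigroup_generated:
  assumes "finite A" "Gcd A = 1"
  shows "numerical_semigroup (generated A)"
proof -
  obtain N where N: "\<And>x. x \<ge> N \<Longrightarrow> x \<in> generated A"
    using generated_contains_large_multiples[OF assms(1)] assms(2) by auto
  have "- generated A \<subseteq> {..<N}" using N by (auto simp: not_le[symmetric])
  then have "finite (- generated A)" by (rule finite_subset) simp
  moreover have "0 \<in> generated A"
    unfolding generated_def by (auto intro!: exI[of _ "\<lambda>_. 0"])
  moreover have "x + y \<in> generated A" if xy: "x \<in> generated A" "y \<in> generated A" for x y
  proof -
    obtain c e where "x = (\<Sum>z\<in>A. c z * z)" "y = (\<Sum>z\<in>A. e z * z)"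
      using xy by (auto simp: generated_def)
    then have "x + y = (\<Sum>z\<in>A. (c z + e z) * z)"
      by (simp add: sum.distrib add_mult_distrib)
    then show ?thesis
      unfolding generated_def by (auto intro!: exI[of _ "\<lambda>z. c z + e z"])
  qed
  ultimately show ?thesis by (simp add: numerical_semigroup_def)
qed

lemma numerical_semigroup_quotient:
  assumes "numerical_semigroup S" "d > 0"
  shows "numerical_semigroup (semigroup_quotient S d)"
proof -
  have "- semigroup_quotient S d = (\<lambda>x. d * x) -` (- S)" by (auto simp: semigroup_quotient_def)
  moreover have "finite ((\<lambda>x. d * x) -` (- S))"
    using assms by (intro finite_vimageI) (auto simp: numerical_semigroup_def inj_on_def)
  ultimately show ?thesis
    using assms(1) by (auto simp: numerical_semigroup_def semigroup_quotient_def distrib_left)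
qed

end

theory Submission
  imports Defs
begin

text \<open>
  Everything rests on one description of the semigroup: an element of \<open>S\<close> is either \<open>0\<close> or of the
  form \<open>c * a + j * k\<close> with \<open>c \<ge> 1\<close> and \<open>j\<close> arbitrary.  Indeed, \<open>a\<close> copies of the step \<open>k\<close> can be
  traded for \<open>k\<close> further copies of \<open>a\<close>, so that the bound on \<open>j\<close> coming from the number of summands
  never matters (\<open>generated_arithmetic_progression\<close>).

  In this form division by \<open>d\<close> is transparent.  Write \<open>k = d * m\<close>.  As \<open>d\<close> is coprime to \<open>a\<close>,
  a representation \<open>d * x = c * a + j * (d * m)\<close> forces \<open>d dvd c\<close>, so the quotient is the semigroup of
  the same form with \<open>m\<close> in place of \<open>k\<close> (\<open>quotient_scaled_step\<close>).

  The gaps of that semigroup are the numbers \<open>j * m - c * a > 0\<close> with \<open>0 < j < a\<close> and \<open>c \<ge> 0\<close>, each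
  obtained from a single pair \<open>(j, c)\<close> (\<open>gaps_image\<close>, \<open>inj_on_gap_pairs\<close>).  These pairs are the
  points of the grid \<open>{1..a-1} \<times> {0..m}\<close> on one side of the line \<open>c * a = j * m\<close>.  No grid point is on
  the line, and the half turn \<open>(j, c) \<mapsto> (a - j, m - c)\<close> of the grid exchanges the two sides,
  whence the genus is \<open>(a - 1) * (m + 1) / 2\<close> (\<open>card_gap_pairs\<close>).  For \<open>a > 1\<close> the
  largest gap has \<open>j = a - 1\<close> and \<open>c = 0\<close>, so the Frobenius number is \<open>(a - 1) * m\<close>.  For \<open>a = 1\<close>
  there are no gaps, and this value agrees with the convention that the Frobenius number is then \<open>0\<close>.
  The formula follows.
\<close>

section \<open>The semigroup of an arithmetic progression and its quotients\<close>

lemma generated_subset_submonoid: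
  assumes "0 \<in> T" "\<And>x y. x \<in> T \<Longrightarrow> y \<in> T \<Longrightarrow> x + y \<in> T" "A \<subseteq> T"
  shows "generated A \<subseteq> T"
proof -
  have mult: "n * x \<in> T" if "x \<in> T" for n x
    by (induction n) (use assms that in auto)
  have "(\<Sum>x\<in>A. c x * x) \<in> T" for c
    using assms(3)
    by (induction A rule: infinite_finite_induct) (use assms(1,2) mult in auto)
  then show ?thesis by (auto simp: generated_def)
qed

definition progression_semigroup :: "nat \<Rightarrow> nat \<Rightarrow> nat set" where
  "progression_semigroup a m = {x. x = 0 \<or> (\<exists>c j. c \<ge> 1 \<and> x = c * a + j * m)}"

lemma progression_semigroupI:
  "c \<ge> 1 \<Longrightarrow> x = c * a + j * m \<Longrightarrow> x \<in> progression_semigroup a m"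
  unfolding progression_semigroup_def by blast

lemma generated_arithmetic_progression:
  fixes a k :: nat
  assumes "a > 0"
  shows "generated {a + i * k | i. i < a} = progression_semigroup a k"
proof
  have gens: "a + i * k \<in> progression_semigroup a k" for i
    by (rule progression_semigroupI[of 1 _ _ i]) simp_all
  have add: "x + y \<in> progression_semigroup a k"
    if xy: "x \<in> progression_semigroup a k" "y \<in> progression_semigroup a k" for x y
  proof (cases "x = 0 \<or> y = 0")
    case False
    then obtain c j c' j' where "c \<ge> 1" "x = c * a + j * k" "y = c' * a + j' * k"
      using xy by (auto simp: progression_semigroup_def)
    then have "c + c' \<ge> 1" "x + y = (c + c') * a + (j + j') * k"
      by (auto simp: algebra_simps)
    then show ?thesis by (rule progression_semigroupI)
  qed (use xy in auto)
  show "generated {a + i * k | i. i < a} \<subseteq> progression_semigroup a k"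
    by (rule generated_subset_submonoid) (use gens add in \<open>auto simp: progression_semigroup_def\<close>)
next
  let ?A = "{a + i * k | i. i < a}"
  have fin: "finite ?A" by simp
  show "progression_semigroup a k \<subseteq> generated ?A"
  proof
    fix x assume "x \<in> progression_semigroup a k"
    then consider "x = 0" | c j where "c \<ge> 1" "x = c * a + j * k"
      by (auto simp: progression_semigroup_def)
    then show "x \<in> generated ?A"
    proof cases
      case 1
      then show ?thesis unfolding generated_def by (auto intro!: exI[of _ "\<lambda>_. 0"])
    next
      case (2 c j)
      \<comment> \<open>Since \<open>a * k = k * a\<close>, the multiple of \<open>k\<close> may be reduced modulo \<open>a\<close> at the price of
        additional copies of \<open>a\<close>; then one generator absorbs all of it.\<close>
      define r e where "r = j mod a" and "e = c + (j div a) * k - 1"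
      have "x = (c + (j div a) * k) * a + r * k"
      proof -
        have "j * k = ((j div a) * a + r) * k" by (simp add: r_def)
        then show ?thesis using 2 by (simp add: algebra_simps)
      qed
      moreover have "c + (j div a) * k = Suc e" using 2 by (simp add: e_def)
      ultimately have x: "x = e * a + (a + r * k)" by simp
      have "r < a" using assms by (simp add: r_def)
      then have mem: "a + r * k \<in> ?A" by blast
      have "a + 0 * k \<in> ?A" using assms by blast
      then have mem': "a \<in> ?A" by simp
      define f where "f = (\<lambda>y. (if y = a then e else 0) + (if y = a + r * k then 1 else 0))"
      have "(\<Sum>y\<in>?A. f y * y) =
          (\<Sum>y\<in>?A. (if y = a then e * a else 0) + (if y = a + r * k then a + r * k else 0))"
        by (rule sum.cong) (auto simp: f_def algebra_simps)
      also have "\<dots> = e * a + (a + r * k)"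
        unfolding sum.distrib using fin mem mem' by (simp only: sum.delta if_True)
      finally show ?thesis unfolding generated_def x by (auto intro!: exI[of _ f])
    qed
  qed
qed

lemma quotient_scaled_step:
  fixes a d m :: nat
  assumes "d > 0" "coprime d a"
  shows "semigroup_quotient (progression_semigroup a (d * m)) d = progression_semigroup a m"
proof -
  have "x \<in> progression_semigroup a m" if dx: "d * x \<in> progression_semigroup a (d * m)" for x
  proof (cases "x = 0")
    case False
    then obtain c j where x: "c \<ge> 1" "d * x = c * a + j * (d * m)"
      using dx assms(1) by (auto simp: progression_semigroup_def)
    have "d dvd c * a + d * (j * m)" using x(2) by (metis dvd_triv_left mult.left_commute)
    then have "d dvd c * a" by (simp add: dvd_add_left_iff)
    then have "d dvd c" using assms(2) by (simp add: coprime_dvd_mult_left_iff)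
    then obtain e where e: "c = d * e" by blast
    have "d * x = d * (e * a + j * m)" using x(2) e by (simp add: algebra_simps)
    then have "x = e * a + j * m" using assms(1) by simp
    moreover have "e \<ge> 1" using e x(1) by (cases e) auto
    ultimately show ?thesis by (intro progression_semigroupI)
  qed (simp add: progression_semigroup_def)
  moreover have "d * x \<in> progression_semigroup a (d * m)" if x: "x \<in> progression_semigroup a m" for x
  proof (cases "x = 0")
    case False
    then obtain c j where "c \<ge> 1" "x = c * a + j * m"
      using x by (auto simp: progression_semigroup_def)
    then have "d * c \<ge> 1" "d * x = (d * c) * a + j * (d * m)"
      using assms(1) by (auto simp: algebra_simps)
    then show ?thesis by (rule progression_semigroupI)
  qed (simp add: progression_semigroup_def)
  ultimately show ?thesis by (auto simp: semigroup_quotient_def)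
qed

section \<open>Gaps as lattice points\<close>

definition gap_pairs :: "nat \<Rightarrow> nat \<Rightarrow> (nat \<times> nat) set" where
  "gap_pairs a m = {(j, c). 0 < j \<and> j < a \<and> c * a < j * m}"

lemma eq_if_cong_multiples:
  fixes a m i j :: nat
  assumes "coprime a m" "i < a" "j < a" "i * m + u * a = j * m + v * a"
  shows "i = j"
proof -
  have "[i * m + u * a = j * m + v * a] (mod a)" using assms(4) by simp
  then have "[i * m = j * m] (mod a)" by (simp add: cong_def)
  then have "[i = j] (mod a)"
    using assms(1) by (simp add: cong_mult_rcancel_nat coprime_commute)
  then show ?thesis using assms(2,3) by (simp add: cong_def)
qed

lemma inj_on_gap_pairs:
  assumes "coprime a m"
  shows "inj_on (\<lambda>(j, c). j * m - c * a) (gap_pairs a m)"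
proof (rule inj_onI, clarify)
  fix j c j' c'
  assume P: "(j, c) \<in> gap_pairs a m" "(j', c') \<in> gap_pairs a m"
    and "j * m - c * a = j' * m - c' * a"
  then have eq: "j * m + c' * a = j' * m + c * a" by (auto simp: gap_pairs_def)
  moreover have "j = j'"
    using eq_if_cong_multiples[OF assms _ _ eq] P by (auto simp: gap_pairs_def)
  ultimately show "j = j' \<and> c = c'" using P by (auto simp: gap_pairs_def)
qed

text \<open>
  By coprimality every integer is \<open>j * m + e * a\<close> for exactly one \<open>j\<close> with \<open>0 \<le> j < a\<close> and one
  integer \<open>e\<close>, and a positive integer is in the semigroup iff \<open>e \<ge> 1\<close>.  For a gap put \<open>c = - e \<ge> 0\<close>.
\<close>
lemma gaps_image:
  assumes "a > 0" "coprime a m"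
  shows "- progression_semigroup a m = (\<lambda>(j, c). j * m - c * a) ` gap_pairs a m"
proof (intro equalityI subsetI)
  fix n assume "n \<in> - progression_semigroup a m"
  then have n: "n > 0" "\<And>c j. c \<ge> 1 \<Longrightarrow> n \<noteq> c * a + j * m"
    by (auto simp: progression_semigroup_def)
  obtain v where v: "[m * v = 1] (mod a)"
    using cong_solve_coprime_nat[of m a] assms(2) by (auto simp: coprime_commute)
  define j where "j = (v * n) mod a"
  have j: "j < a" using assms(1) by (simp add: j_def)
  have "[j * m = v * n * m] (mod a)" unfolding j_def by (intro cong_scalar_right) simp
  also have "[v * n * m = n] (mod a)"
    using cong_scalar_right[OF v, of n] by (simp add: ac_simps)
  finally have cong: "[j * m = n] (mod a)" .
  have "\<exists>c. j * m = n + c * a"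
  proof (cases "n \<le> j * m")
    case True
    then have "a dvd j * m - n" using cong by (simp add: cong_altdef_nat)
    then obtain c where "j * m - n = a * c" by blast
    then show ?thesis using True by (auto simp: algebra_simps intro!: exI[of _ c])
  next
    case False
    then have "a dvd n - j * m" using cong by (simp add: cong_altdef_nat cong_sym_eq)
    then obtain c where "n - j * m = a * c" by blast
    then have "n = c * a + j * m" "c \<ge> 1" using False by (cases c; simp add: algebra_simps)+
    then show ?thesis using n(2) by blast
  qed
  then obtain c where c: "j * m = n + c * a" by blast
  then have "(j, c) \<in> gap_pairs a m" using j n(1) by (cases j) (auto simp: gap_pairs_def)
  then show "n \<in> (\<lambda>(j, c). j * m - c * a) ` gap_pairs a m" using c by force
next
  fix n assume "n \<in> (\<lambda>(j, c). j * m - c * a) ` gap_pairs a m"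
  then obtain j c where P: "0 < j" "j < a" "c * a < j * m" "n = j * m - c * a"
    by (auto simp: gap_pairs_def)
  have "n \<noteq> e * a + i * m" if "e \<ge> 1" for e i
  proof
    assume "n = e * a + i * m"
    then have eq: "j * m + 0 * a = i * m + (c + e) * a" using P by (simp add: algebra_simps)
    have "e * a > 0" using that P by simp
    then have "i * m < j * m" using eq by (simp add: algebra_simps)
    then have "i < j" by simp
    then have "j = i" using eq_if_cong_multiples[OF assms(2) _ _ eq] P by simp
    with \<open>i < j\<close> show False by simp
  qed
  then show "n \<in> - progression_semigroup a m" using P by (auto simp: progression_semigroup_def)
qed

text \<open>
  No point with \<open>0 < j < a\<close> satisfies \<open>c * a = j * m\<close>, by coprimality.  Hence the grid
  \<open>{1..a-1} \<times> {0..m}\<close> is the disjoint union of the gap pairs and of their image under the half turn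
  about its centre.
\<close>
lemma card_gap_pairs:
  assumes "coprime a m"
  shows "2 * card (gap_pairs a m) = (a - 1) * (m + 1)"
proof -
  define R where "R = {0<..<a} \<times> {0..m}"
  define h where "h = (\<lambda>(j, c). (a - j, m - c))"
  define P where "P = gap_pairs a m"
  have sub: "P \<subseteq> R"
  proof clarify
    fix j c assume "(j, c) \<in> P"
    then have P: "0 < j" "j < a" "c * a < j * m" by (auto simp: P_def gap_pairs_def)
    have "j * m \<le> m * a" using P by (simp add: mult.commute)
    then have "c * a < m * a" using P(3) by linarith
    then show "(j, c) \<in> R" using P by (simp add: R_def)
  qed
  have refl: "h p \<in> P \<longleftrightarrow> p \<notin> P" if p: "p \<in> R" for p
  proof -
    obtain j c where jc: "p = (j, c)" "0 < j" "j < a" "c \<le> m"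
      using p by (auto simp: R_def)
    have "j * m + 0 * a \<noteq> 0 * m + c * a"
      using eq_if_cong_multiples[OF assms, of j 0 0 c] jc by linarith
    then have ne: "c * a \<noteq> j * m" by simp
    have "(m - c) * a < (a - j) * m \<longleftrightarrow> j * m < c * a"
    proof -
      have "(m - c) * a + c * a = m * a" "(a - j) * m + j * m = m * a"
        using jc by (simp_all flip: add_mult_distrib)
      then show ?thesis by linarith
    qed
    then show ?thesis using jc ne by (auto simp: h_def P_def gap_pairs_def)
  qed
  have h_R: "h p \<in> R" and h_h: "h (h p) = p" if "p \<in> R" for p
    using that by (auto simp: R_def h_def)
  have "bij_betw h P (R - P)"
    by (rule bij_betw_byWitness[where f' = h]) (use sub refl h_R h_h in fastforce)+
  then have "card P = card (R - P)" by (rule bij_betw_same_card)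
  moreover have "finite R" by (simp add: R_def)
  then have "card P + card (R - P) = card R"
    using sub by (metis card_Diff_subset card_mono finite_subset le_add_diff_inverse)
  moreover have "card R = (a - 1) * (m + 1)" by (simp add: R_def)
  ultimately show ?thesis by (simp add: P_def)
qed

section \<open>Genus and Frobenius number\<close>

lemma genus_progression_semigroup:
  assumes "a > 0" "coprime a m"
  shows "2 * genus (progression_semigroup a m) = (a - 1) * (m + 1)"
  unfolding genus_def gaps_image[OF assms]
  by (simp add: card_image inj_on_gap_pairs card_gap_pairs assms)

lemma frobenius_progression_semigroup:
  assumes "a > 0" "m > 0" "coprime a m"
  shows "frobenius (progression_semigroup a m) = (a - 1) * m"
proof (cases "a = 1")
  case True
  have "- progression_semigroup a m = {}"
    unfolding gaps_image[OF assms(1,3)] using True by (auto simp: gap_pairs_def)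
  then have "progression_semigroup a m = UNIV" by blast
  then show ?thesis using True by (simp add: frobenius_def)
next
  case False
  have ub: "n \<le> (a - 1) * m" if "n \<in> - progression_semigroup a m" for n
  proof -
    obtain j c where "j < a" "n = j * m - c * a"
      using \<open>n \<in> _\<close> unfolding gaps_image[OF assms(1,3)] by (auto simp: gap_pairs_def)
    moreover from \<open>j < a\<close> have "j * m \<le> (a - 1) * m" by (intro mult_right_mono) auto
    ultimately show ?thesis by linarith
  qed
  have "(a - 1, 0) \<in> gap_pairs a m" using False assms by (auto simp: gap_pairs_def)
  then have mem: "(a - 1) * m \<in> - progression_semigroup a m"
    unfolding gaps_image[OF assms(1,3)] by force
  have "- progression_semigroup a m \<subseteq> {..(a - 1) * m}" using ub by blast
  then have "finite (- progression_semigroup a m)" by (rule finite_subset) simp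
  then have "Max (- progression_semigroup a m) = (a - 1) * m"
    using ub mem by (intro Max_eqI) auto
  moreover have "progression_semigroup a m \<noteq> UNIV" using mem by blast
  ultimately show ?thesis by (simp add: frobenius_def)
qed

theorem proposition3p8:
  fixes a k d :: nat and S :: "nat set"
  assumes "a > 0" and "k > 0" and "coprime a k"
    and "S = generated {a + i * k | i. i < a}"
    and "d > 0" and "d dvd k"
  shows "real (genus (semigroup_quotient S d)) = (real (frobenius (semigroup_quotient S d)) + real a - 1) / 2"
proof -
  obtain m where m: "k = d * m" using assms(6) by blast
  have m_pos: "m > 0" and cop: "coprime d a" "coprime a m"
    using assms(2,3) m by (auto simp: coprime_commute)
  have Q: "semigroup_quotient S d = progression_semigroup a m"
    using assms(4) generated_arithmetic_progression[OF assms(1)]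
      quotient_scaled_step[OF assms(5) cop(1)] m by simp
  let ?T = "progression_semigroup a m"
  have "2 * genus ?T = frobenius ?T + (a - 1)"
    using genus_progression_semigroup[OF assms(1) cop(2)]
      frobenius_progression_semigroup[OF assms(1) m_pos cop(2)] by simp
  then have "2 * real (genus ?T) = real (frobenius ?T) + real (a - 1)"
    by (metis of_nat_add of_nat_mult of_nat_numeral)
  then show ?thesis using assms(1) by (simp add: Q of_nat_diff)
qed

end
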